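(* Let $n>1$ and let $\lambda=(\lambda_1,\dots,\lambda_n)$ be a Ferrers board, i.e. positive integers $\lambda_1\le\lambda_2\le\dots\le\lambda_n$, satisfying $\lambda_i\ge i$ for all $i=1,\dots,n$. For $1\le i\le \lambda_1$ let \[ Q^{\lambda}_i(t)=\sum_{\substack{\sigma\in S_\lambda\\ \sigma_1=i}} t^{\operatorname{asc}(\sigma)} . \] Then the sequence of polynomials $\big(Q^{\lambda}_{\lambda_1}(t),\,Q^{\lambda}_{\lambda_1-1}(t),\,\dots,\,Q^{\lambda}_{2}(t),\,Q^{\lambda}_{1}(t)\big)$ is interlacing. In particular, the rook-Eulerian polynomial $Q^\lambda(t)=\sum_{\sigma\in S_\lambda}t^{\operatorname{asc}(\sigma)}=\sum_{i=1}^{\lambda_1}Q^\lambda_i(t)$ is real-rooted.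
   Context: A row-complete rook placement on $\lambda$ is a word $\sigma=\sigma_1\sigma_2\cdots\sigma_n$ of distinct positive integers with $1\le\sigma_i\le\lambda_i$ for every $i$ (a rook in row $i$ in column $\sigma_i$; each row has exactly one rook, each column at most one). $S_\lambda$ denotes the set of all row-complete rook placements on $\lambda$. An ascent of $\sigma$ is an index $i\in[n-1]$ with $\sigma_i<\sigma_{i+1}$, and $\operatorname{asc}(\sigma)$ is the number of ascents. For real-rooted polynomials $f,g$ with positive leading coefficients and all zeros real and non-positive, with zeros $a_1\ge a_2\ge\cdots$ of $f$ and $b_1\ge b_2\ge\cdots$ of $g$, one writes $f\preceq g$ ("$f$ interlaces $g$") if $\cdots\le a_3\le b_3\le a_2\le b_2\le a_1\le b_1\le 0$ (so $\deg g\in\{\deg f,\deg f+1\}$). A sequence $(f_1,\dots,f_k)$ of real-rooted polynomials is interlacing if $f_i\preceq f_j$ for all $1\le i<j\le k$. *)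

theory Defs
  imports Complex_Main "HOL-Computational_Algebra.Computational_Algebra"
begin

text \<open>
  Boards and placements are lists, indexed from 0: \<open>lam ! i\<close> is the length of row \<open>i + 1\<close>,
  and \<open>\<sigma> ! i\<close> is the column (counted from 1) of the rook in row \<open>i + 1\<close>.
\<close>

definition ferrers_board :: "nat list \<Rightarrow> bool" where
  "ferrers_board lam \<longleftrightarrow> sorted lam \<and> (\<forall>l \<in> set lam. 0 < l)"

definition row_complete_placements :: "nat list \<Rightarrow> nat list set" where
  "row_complete_placements lam =
     {\<sigma>. length \<sigma> = length lam \<and> distinct \<sigma> \<and>
          (\<forall>i < length lam. 1 \<le> \<sigma> ! i \<and> \<sigma> ! i \<le> lam ! i)}"

lemma finite_row_complete_placements: "finite (row_complete_placements lam)"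
proof (rule finite_subset)
  show "row_complete_placements lam
          \<subseteq> {\<sigma>. set \<sigma> \<subseteq> {..Max (set lam)} \<and> length \<sigma> = length lam}"
  proof
    fix \<sigma> assume s: "\<sigma> \<in> row_complete_placements lam"
    then have l: "length \<sigma> = length lam" by (simp add: row_complete_placements_def)
    have "x \<le> Max (set lam)" if "x \<in> set \<sigma>" for x
    proof -
      from that obtain i where i: "i < length lam" "x = \<sigma> ! i"
        using l by (metis in_set_conv_nth)
      then have "x \<le> lam ! i" using s by (simp add: row_complete_placements_def)
      also have "lam ! i \<le> Max (set lam)" using i by simp
      finally show ?thesis .
    qed
    with l show "\<sigma> \<in> {\<sigma>. set \<sigma> \<subseteq> {..Max (set lam)} \<and> length \<sigma> = length lam}" by auto
  qed
  show "finite {\<sigma>. set \<sigma> \<subseteq> {..Max (set lam)} \<and> length \<sigma> = length lam}"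
    by (rule finite_lists_length_eq) simp
qed

definition asc :: "nat list \<Rightarrow> nat" where
  "asc \<sigma> = card {i. Suc i < length \<sigma> \<and> \<sigma> ! i < \<sigma> ! Suc i}"

definition Q :: "nat list \<Rightarrow> nat \<Rightarrow> real poly" where
  "Q lam i = (\<Sum>\<sigma> | \<sigma> \<in> row_complete_placements lam \<and> \<sigma> ! 0 = i. monom 1 (asc \<sigma>))"

definition rook_eulerian :: "nat list \<Rightarrow> real poly" where
  "rook_eulerian lam = (\<Sum>\<sigma> \<in> row_complete_placements lam. monom 1 (asc \<sigma>))"

text \<open>The zero polynomial is not real-rooted: every complex number is a zero of it.\<close>

definition real_rooted :: "real poly \<Rightarrow> bool" where
  "real_rooted p \<longleftrightarrow> (\<forall>z::complex. poly (map_poly of_real p) z = 0 \<longrightarrow> z \<in> \<real>)"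

text \<open>Real zeros with multiplicity, in weakly decreasing order.\<close>

definition zeros_desc :: "real poly \<Rightarrow> real list" where
  "zeros_desc p = rev (sorted_list_of_multiset (proots p))"

text \<open>
  Writing \<open>a\<close> and \<open>b\<close> for the zeros of \<open>f\<close> and \<open>g\<close>, the last three conjuncts say
  \<open>\<cdots> \<le> a\<^sub>2 \<le> b\<^sub>2 \<le> a\<^sub>1 \<le> b\<^sub>1\<close>, where the chain ends with the last zero of either polynomial.
\<close>

definition interlaces :: "real poly \<Rightarrow> real poly \<Rightarrow> bool" (infix "\<preceq>" 50) where
  "f \<preceq> g \<longleftrightarrow>
     (\<forall>p \<in> {f, g}. real_rooted p \<and> lead_coeff p > 0 \<and> (\<forall>x. poly p x = 0 \<longrightarrow> x \<le> 0)) \<and>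
     (degree g = degree f \<or> degree g = degree f + 1) \<and>
     (\<forall>k < degree f. zeros_desc f ! k \<le> zeros_desc g ! k) \<and>
     (\<forall>k. k + 1 < degree g \<longrightarrow> zeros_desc g ! (k + 1) \<le> zeros_desc f ! k)"

definition interlacing :: "real poly list \<Rightarrow> bool" where
  "interlacing fs \<longleftrightarrow> (\<forall>f \<in> set fs. real_rooted f) \<and>
     (\<forall>i j. i < j \<and> j < length fs \<longrightarrow> fs ! i \<preceq> fs ! j)"

end

theory Submission
  imports Defs
begin

text \<open>
  Deleting the first row and the column of its rook gives
  \<open>Q\<^sub>i = \<Sum>\<^bsub>j < i\<^esub> q\<^sub>j + t \<Sum>\<^bsub>j \<ge> i\<^esub> q\<^sub>j\<close>, where the \<open>q\<^sub>j\<close> belong to the smaller board.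
  For fixed \<open>z\<close> in the upper half plane consider the statement: no \<open>Q\<^sub>i(z)\<close> vanishes, and for
  \<open>j \<le> i\<close> the quotient \<open>Q\<^sub>j(z) / Q\<^sub>i(z)\<close> lies in the convex cone spanned by \<open>1\<close> and \<open>z\<close>.
  The recursion preserves it by elementary algebra, and nonvanishing also passes to the sum of
  the \<open>Q\<^sub>i\<close>, which gives all the real-rootedness claims. To recover the interlacing of \<open>f\<close> and \<open>g\<close>,
  follow the continuous argument of \<open>g / f\<close> along a horizontal line from \<open>+\<infinity>\<close>: it starts near \<open>0\<close>
  and cannot leave \<open>[0, pi]\<close>. As the line approaches the real axis the argument at \<open>x\<close> tends to
  \<open>pi\<close> times the difference of the numbers of zeros of \<open>g\<close> and \<open>f\<close> above \<open>x\<close>, so this difference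
  is \<open>0\<close> or \<open>1\<close>.
\<close>

section \<open>Evaluation at complex points\<close>

definition ceval :: "real poly \<Rightarrow> complex \<Rightarrow> complex" where
  "ceval p z = poly (map_poly of_real p) z"

lemma ceval_0 [simp]: "ceval 0 z = 0"
  by (simp add: ceval_def)

lemma ceval_pCons [simp]: "ceval (pCons a p) z = of_real a + z * ceval p z"
  by (simp add: ceval_def map_poly_pCons)

lemma ceval_1 [simp]: "ceval 1 z = 1"
  by (simp add: ceval_def)

lemma ceval_add [simp]: "ceval (p + q) z = ceval p z + ceval q z"
proof -
  have "map_poly of_real (p + q) = map_poly of_real p + (map_poly of_real q :: complex poly)"
    by (rule poly_eqI) (simp add: coeff_map_poly)
  then show ?thesis
    by (simp add: ceval_def)
qed

lemma ceval_smult [simp]: "ceval (smult c p) z = of_real c * ceval p z"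
  by (induction p) (simp_all add: algebra_simps)

lemma ceval_mult [simp]: "ceval (p * q) z = ceval p z * ceval q z"
  by (induction p) (simp_all add: algebra_simps)

lemma ceval_sum [simp]: "ceval (sum f S) z = (\<Sum>x\<in>S. ceval (f x) z)"
  by (induction S rule: infinite_finite_induct) simp_all

lemma ceval_prod_mset [simp]: "ceval (prod_mset M) z = (\<Prod>p\<in>#M. ceval p z)"
  by (induction M) simp_all

lemma ceval_of_real [simp]: "ceval p (of_real x) = of_real (poly p x)"
  by (induction p) simp_all

lemma ceval_cnj: "ceval p (cnj z) = cnj (ceval p z)"
  by (induction p) simp_all

lemma real_rooted_iff: "real_rooted p \<longleftrightarrow> (\<forall>z. ceval p z = 0 \<longrightarrow> z \<in> \<real>)"
  by (simp add: real_rooted_def ceval_def)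

lemma real_rootedI_upper_half_plane:
  assumes "\<And>z. Im z > 0 \<Longrightarrow> ceval p z \<noteq> 0"
  shows "real_rooted p"
  unfolding real_rooted_iff
proof (intro allI impI)
  fix z assume z: "ceval p z = 0"
  show "z \<in> \<real>"
  proof (rule ccontr)
    assume "z \<notin> \<real>"
    then have "Im z > 0 \<or> Im (cnj z) > 0"
      by (auto simp: complex_is_Real_iff)
    then show False
      using assms z by (metis ceval_cnj complex_cnj_zero)
  qed
qed

lemma real_rooted_nonzero: "real_rooted p \<Longrightarrow> p \<noteq> 0"
  by (metis ceval_0 complex_is_Real_iff imaginary_unit.sel(2) real_rooted_iff zero_neq_one)

section \<open>Real-rooted polynomials as products of real linear factors\<close>

lemma real_rooted_factorization_ex:
  assumes "real_rooted p"
  shows "\<exists>c M. c \<noteq> 0 \<and> p = smult c (\<Prod>a\<in>#M. [:-a, 1:])"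
  using assms
proof (induction "degree p" arbitrary: p)
  case 0
  then obtain c where "p = [:c:]"
    by (metis degree_0_id of_nat_0 degree_eq_zeroE)
  then show ?case
    using real_rooted_nonzero[OF 0(2)] by (intro exI[of _ c] exI[of _ "{#}"]) auto
next
  case (Suc n)
  have "degree (map_poly of_real p :: complex poly) = Suc n"
    using Suc(2) real_rooted_nonzero[OF Suc(3)] by (simp add: map_poly_degree_eq)
  then obtain z where z: "ceval p z = 0"
    unfolding ceval_def using alg_closed_imp_poly_has_root[of "map_poly of_real p :: complex poly"] by auto
  then obtain x where x: "z = of_real x"
    using Suc(3) by (auto simp: real_rooted_iff elim: Reals_cases)
  then have "poly p x = 0"
    using z by simp
  then obtain q where q: "p = [:-x, 1:] * q"
    by (auto simp: poly_eq_0_iff_dvd)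
  have "real_rooted q"
    using Suc(3) unfolding real_rooted_iff q ceval_mult by simp
  moreover have "degree q = n"
    using Suc(2) real_rooted_nonzero[OF Suc(3)] unfolding q by (subst (asm) degree_mult_eq) auto
  ultimately obtain c M where "c \<noteq> 0" "q = smult c (\<Prod>a\<in>#M. [:-a, 1:])"
    using Suc(1) by blast
  then show ?case
    using q by (intro exI[of _ c] exI[of _ "add_mset x M"]) simp
qed

lemma prod_linear_nonzero: "(\<Prod>a\<in>#M. [:-a, 1 :: real:]) \<noteq> 0"
  by (induction M) (simp_all del: mult_pCons_left)

lemma proots_prod_linear: "proots (\<Prod>a\<in>#M. [:-a, 1 :: real:]) = M"
proof (induction M)
  case (add a M)
  have "proots ([:-a, 1:] * (\<Prod>a\<in>#M. [:-a, 1:])) = proots [:-a, 1:] + proots (\<Prod>a\<in>#M. [:-a, 1:])"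
    by (intro proots_mult prod_linear_nonzero) simp
  then show ?case using add by simp
qed simp

lemma real_rooted_factorization:
  assumes "real_rooted p"
  obtains c where "p = smult c (\<Prod>a\<in>#proots p. [:-a, 1:])" "c = lead_coeff p"
    "size (proots p) = degree p"
proof -
  obtain c M where M: "c \<noteq> 0" "p = smult c (\<Prod>a\<in>#M. [:-a, 1:])"
    using real_rooted_factorization_ex[OF assms] by blast
  have "degree (\<Prod>a\<in>#M. [:-a, 1 :: real:]) = size M"
  proof (induction M)
    case (add a M)
    then show ?case
      using degree_mult_eq[of "[:-a, 1:]" "\<Prod>a\<in>#M. [:-a, 1:]"] prod_linear_nonzero[of M] by simp
  qed simp
  moreover have "lead_coeff (\<Prod>a\<in>#M. [:-a, 1 :: real:]) = 1"
  proof (induction M)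
    case (add a M)
    then show ?case
      using lead_coeff_mult[of "[:-a, 1:]" "\<Prod>a\<in>#M. [:-a, 1:]"] by simp
  qed simp
  ultimately have p: "proots p = M" "size (proots p) = degree p" "c = lead_coeff p"
    using M by (simp_all add: proots_prod_linear)
  have "p = smult c (\<Prod>a\<in>#proots p. [:-a, 1:])"
    unfolding p(1) by (fact M(2))
  then show ?thesis using p(3,2) by (rule that)
qed

section \<open>The cone spanned by 1 and a point of the upper half plane\<close>

text \<open>With nonzero \<open>u\<close>, the ratio of \<open>v\<close> to \<open>u\<close> has argument between \<open>0\<close> and that of \<open>z\<close>;
  for values of polynomials this encodes \<open>f \<preceq> g\<close> and \<open>g \<preceq> t f\<close> simultaneously.\<close>

definition cone :: "complex \<Rightarrow> complex set" where
  "cone z = {of_real a + of_real b * z | a b. a \<ge> 0 \<and> b \<ge> 0}"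

lemma cone_real: "a \<ge> 0 \<Longrightarrow> of_real a \<in> cone z"
  unfolding cone_def by force

lemma cone_0: "0 \<in> cone z"
  using cone_real[of 0] by simp

lemma cone_add:
  assumes "u \<in> cone z" "v \<in> cone z" shows "u + v \<in> cone z"
proof -
  obtain a b c d where "a \<ge> 0" "b \<ge> 0" "c \<ge> 0" "d \<ge> 0"
    "u = of_real a + of_real b * z" "v = of_real c + of_real d * z"
    using assms unfolding cone_def by blast
  then have "u + v = of_real (a + c) + of_real (b + d) * z" "0 \<le> a + c" "0 \<le> b + d"
    by (simp_all add: algebra_simps)
  then show ?thesis unfolding cone_def by blast
qed

lemma cone_scale:
  assumes "u \<in> cone z" "r \<ge> 0" shows "of_real r * u \<in> cone z"
proof -
  obtain a b where "a \<ge> 0" "b \<ge> 0" "u = of_real a + of_real b * z"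
    using assms unfolding cone_def by blast
  then have "of_real r * u = of_real (r * a) + of_real (r * b) * z" "0 \<le> r * a" "0 \<le> r * b"
    using assms by (simp_all add: algebra_simps)
  then show ?thesis unfolding cone_def by blast
qed

text \<open>Up to scaling, \<open>z * cnj u\<close> reflects the cone in its bisector:
  \<open>1\<close> goes to \<open>z\<close>, and \<open>z\<close> goes to the nonnegative real
  \<open>z * cnj z\<close>.\<close>

lemma cone_mult_cnj:
  assumes "u \<in> cone z" shows "z * cnj u \<in> cone z"
proof -
  obtain a b where "a \<ge> 0" "b \<ge> 0" "u = of_real a + of_real b * z"
    using assms unfolding cone_def by blast
  then have "z * cnj u = of_real a * z + of_real b * (z * cnj z)"
    by (simp add: algebra_simps)
  also have "\<dots> = of_real (b * (cmod z)\<^sup>2) + of_real a * z"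
    unfolding of_real_mult complex_norm_square by simp
  finally show ?thesis unfolding cone_def using \<open>a \<ge> 0\<close> \<open>b \<ge> 0\<close>
    by (metis (mono_tags, lifting) mem_Collect_eq mult_nonneg_nonneg zero_le_power2)
qed

lemma cone_sum: "(\<And>x. x \<in> S \<Longrightarrow> f x \<in> cone z) \<Longrightarrow> sum f S \<in> cone z"
  by (induction S rule: infinite_finite_induct) (auto intro: cone_add cone_0)

lemma cone_self_mult_cnj: "u * cnj u \<in> cone z"
  using cone_real[of "(cmod u)\<^sup>2"] by (simp only: complex_norm_square zero_le_power2)

lemma cone_Im: "u \<in> cone z \<Longrightarrow> Im z > 0 \<Longrightarrow> Im u \<ge> 0"
  unfolding cone_def by auto

lemma cone_not_negative: "u \<in> cone z \<Longrightarrow> Im z > 0 \<Longrightarrow> Im u = 0 \<Longrightarrow> Re u \<ge> 0"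
  unfolding cone_def by auto

text \<open>This is the induction step for a pair of indices: \<open>A\<close>, \<open>B\<close>,
  \<open>C\<close> are sums over upper, middle and lower indices. After expansion, every product
  whose conjugation is the wrong way round carries a factor \<open>z\<close>, so
  \<open>cone_mult_cnj\<close> applies.\<close>

lemma cone_blocks:
  assumes "B * cnj A \<in> cone z" "C * cnj A \<in> cone z" "C * cnj B \<in> cone z"
  shows "(z * A + z * B + C) * cnj (z * A + B + C) \<in> cone z"
proof -
  have "(z * A + z * B + C) * cnj (z * A + B + C) =
      (z * A + C) * cnj (z * A + C) + z * cnj (B * cnj B) + z * cnj (B * cnj A) +
      of_real ((cmod z)\<^sup>2) * (B * cnj A) + z * cnj (C * cnj B) + C * cnj B"
    unfolding complex_norm_square by (simp add: algebra_simps)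
  also have "\<dots> \<in> cone z"
    using assms by (intro cone_add cone_self_mult_cnj cone_mult_cnj cone_scale) auto
  finally show ?thesis .
qed

text \<open>Multiplying a vanishing sum by \<open>cnj (u k)\<close> turns the term of
  \<open>k\<close> into a positive real, so the others would add up to a negative real, which the
  cone does not contain.\<close>

lemma cone_sum_nonzero:
  assumes "finite I" "k \<in> I" "u k \<noteq> 0" "Im z > 0" "\<And>j. j \<in> I \<Longrightarrow> u j * cnj (u k) \<in> cone z"
  shows "(\<Sum>j\<in>I. u j) \<noteq> 0"
proof
  assume 0: "(\<Sum>j\<in>I. u j) = 0"
  let ?w = "\<Sum>j\<in>I - {k}. u j * cnj (u k)"
  have w: "?w \<in> cone z" using assms by (intro cone_sum) auto
  have "of_real ((cmod (u k))\<^sup>2) + ?w = (\<Sum>j\<in>I. u j * cnj (u k))"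
    unfolding complex_norm_square using assms(1,2) by (simp add: sum.remove[of I k])
  also have "\<dots> = 0" using 0 by (simp flip: sum_distrib_right)
  finally have "?w = of_real (- ((cmod (u k))\<^sup>2))"
    by (simp add: add_eq_0_iff)
  then show False
    using cone_not_negative[OF w \<open>Im z > 0\<close>] \<open>u k \<noteq> 0\<close> by simp
qed

text \<open>If the sum vanished, \<open>D * cnj A\<close> would be a nonpositive multiple of
  \<open>z\<close>; its imaginary part forces \<open>A = 0\<close>, and then
  \<open>D = 0\<close>.\<close>

lemma cone_shift_nonzero:
  assumes "D * cnj A \<in> cone z" "Im z > 0" "A \<noteq> 0 \<or> D \<noteq> 0"
  shows "z * A + D \<noteq> 0"
proof
  assume 0: "z * A + D = 0"
  then have "D = - (z * A)"
    using add_eq_0_iff by blast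
  then have "D * cnj A = - (z * of_real ((cmod A)\<^sup>2))"
    unfolding complex_norm_square by simp
  then have "A = 0"
    using cone_Im[OF assms(1,2)] \<open>Im z > 0\<close> by (auto simp: zero_le_mult_iff mult_le_0_iff)
  then show False using 0 assms(3) by simp
qed

section \<open>Removing the first row\<close>

text \<open>The increasing bijection onto the naturals other than \<open>i\<close>: it reinserts a
  deleted column \<open>i\<close> without changing ascents.\<close>

definition skip :: "nat \<Rightarrow> nat \<Rightarrow> nat" where
  "skip i y = (if y < i then y else Suc y)"

lemma skip_less_iff: "skip i x < skip i y \<longleftrightarrow> x < y"
  by (auto simp: skip_def)

lemma inj_skip: "inj (skip i)"
  by (auto simp: skip_def inj_def split: if_splits)

lemma skip_neq: "skip i y \<noteq> i"
  by (auto simp: skip_def)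

lemma ex_skip: "x \<noteq> i \<Longrightarrow> \<exists>y. x = skip i y"
  by (rule exI[of _ "if x < i then x else x - 1"]) (auto simp: skip_def)

lemma asc_map_skip: "asc (map (skip i) \<tau>) = asc \<tau>"
  unfolding asc_def by (rule arg_cong[where f = card]) (auto simp: skip_less_iff)

lemma asc_Cons: "\<tau> \<noteq> [] \<Longrightarrow> asc (x # \<tau>) = (if x < \<tau> ! 0 then 1 else 0) + asc \<tau>"
proof -
  assume ne: "\<tau> \<noteq> []"
  have "{i. Suc i < length (x # \<tau>) \<and> (x # \<tau>) ! i < (x # \<tau>) ! Suc i} =
      (if x < \<tau> ! 0 then {0} else {}) \<union> Suc ` {i. Suc i < length \<tau> \<and> \<tau> ! i < \<tau> ! Suc i}"
    (is "?L = ?R")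
  proof (rule set_eqI)
    fix k show "k \<in> ?L \<longleftrightarrow> k \<in> ?R" using ne by (cases k) auto
  qed
  moreover have "finite {i. Suc i < length \<tau> \<and> \<tau> ! i < \<tau> ! Suc i}"
    by (rule finite_subset[of _ "{..<length \<tau>}"]) auto
  ultimately show ?thesis
    unfolding asc_def by (simp add: card_insert_if card_image)
qed

definition remove_column :: "nat list \<Rightarrow> nat list" where
  "remove_column lam = map (\<lambda>x. x - 1) (tl lam)"

text \<open>Since \<open>i\<close> is at most \<open>l\<close> and rows weakly increase, column
  \<open>i\<close> meets every later row, so its deletion shortens each of them by exactly one
  cell.\<close>

lemma placements_first_column:
  assumes "sorted (l # ls)" "1 \<le> i" "i \<le> l"
  shows "{\<sigma> \<in> row_complete_placements (l # ls). \<sigma> ! 0 = i} =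
    (\<lambda>\<tau>. i # map (skip i) \<tau>) ` row_complete_placements (remove_column (l # ls))"
proof (intro equalityI subsetI)
  fix \<sigma> assume "\<sigma> \<in> {\<sigma> \<in> row_complete_placements (l # ls). \<sigma> ! 0 = i}"
  then have s: "length \<sigma> = Suc (length ls)" "distinct \<sigma>" "\<sigma> ! 0 = i"
    "\<And>k. k < Suc (length ls) \<Longrightarrow> 1 \<le> \<sigma> ! k \<and> \<sigma> ! k \<le> (l # ls) ! k"
    by (auto simp: row_complete_placements_def)
  then obtain \<rho> where \<rho>: "\<sigma> = i # \<rho>" "length \<rho> = length ls" "i \<notin> set \<rho>" "distinct \<rho>"
    by (cases \<sigma>) auto
  then have "\<forall>x\<in>set \<rho>. \<exists>y. x = skip i y"
    using ex_skip by metis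
  then obtain d where d: "\<And>x. x \<in> set \<rho> \<Longrightarrow> x = skip i (d x)"
    by metis
  define \<tau> where "\<tau> = map d \<rho>"
  have \<rho>': "\<rho> = map (skip i) \<tau>"
    unfolding \<tau>_def using d by (auto simp: map_idI)
  have "distinct \<tau>" using \<rho>(4) unfolding \<rho>' by (auto simp: distinct_map)
  moreover have "1 \<le> \<tau> ! k \<and> \<tau> ! k \<le> ls ! k - 1" if "k < length ls" for k
  proof -
    have "\<sigma> ! Suc k = skip i (\<tau> ! k)" "l \<le> ls ! k"
      using that \<rho>(1,2) assms(1) unfolding \<rho>' by auto
    moreover have "1 \<le> \<sigma> ! Suc k" "\<sigma> ! Suc k \<le> ls ! k"
      using s(4)[of "Suc k"] that by auto
    ultimately show ?thesis
      using assms(2,3) unfolding skip_def by (cases "\<tau> ! k < i") auto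
  qed
  ultimately have "\<tau> \<in> row_complete_placements (remove_column (l # ls))"
    using \<rho>(2) unfolding \<rho>' by (auto simp: row_complete_placements_def remove_column_def)
  then show "\<sigma> \<in> (\<lambda>\<tau>. i # map (skip i) \<tau>) ` row_complete_placements (remove_column (l # ls))"
    using \<rho>(1) \<rho>' by auto
next
  fix \<sigma> assume "\<sigma> \<in> (\<lambda>\<tau>. i # map (skip i) \<tau>) ` row_complete_placements (remove_column (l # ls))"
  then obtain \<tau> where t: "\<sigma> = i # map (skip i) \<tau>" "length \<tau> = length ls" "distinct \<tau>"
    "\<And>k. k < length ls \<Longrightarrow> 1 \<le> \<tau> ! k \<and> \<tau> ! k \<le> ls ! k - 1"
    by (auto simp: row_complete_placements_def remove_column_def)
  have "1 \<le> \<sigma> ! k \<and> \<sigma> ! k \<le> (l # ls) ! k" if "k < Suc (length ls)" for k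
  proof (cases k)
    case (Suc m)
    then show ?thesis using that t(4)[of m] t(1,2) by (auto simp: skip_def)
  qed (use assms t in auto)
  moreover have "distinct \<sigma>"
    using t(1,3) inj_on_subset[OF inj_skip] by (auto simp: distinct_map skip_neq[symmetric])
  ultimately show "\<sigma> \<in> {\<sigma> \<in> row_complete_placements (l # ls). \<sigma> ! 0 = i}"
    using t by (auto simp: row_complete_placements_def)
qed

text \<open>The weight \<open>h\<close> serves two purposes: \<open>h = 1\<close> splits the
  rook-Eulerian polynomial, and \<open>h\<close> with values \<open>t\<close> and \<open>1\<close>
  records the ascent created by a new first row.\<close>

lemma sum_monom_first_column:
  assumes "lam \<noteq> []"
  shows "(\<Sum>\<sigma>\<in>row_complete_placements lam. h (\<sigma> ! 0) * monom 1 (asc \<sigma>)) =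
    (\<Sum>j = 1..lam ! 0. h j * Q lam j)"
proof -
  have "(\<Sum>\<sigma>\<in>row_complete_placements lam. h (\<sigma> ! 0) * monom 1 (asc \<sigma>)) =
    (\<Sum>j = 1..lam ! 0. \<Sum>\<sigma> | \<sigma> \<in> row_complete_placements lam \<and> \<sigma> ! 0 = j.
        h (\<sigma> ! 0) * monom 1 (asc \<sigma>))"
    using assms
    by (intro sum.group[symmetric] finite_row_complete_placements)
       (auto simp: row_complete_placements_def)
  also have "\<dots> = (\<Sum>j = 1..lam ! 0. h j * Q lam j)"
    unfolding Q_def sum_distrib_left by (intro sum.cong) auto
  finally show ?thesis .
qed

lemma rook_eulerian_eq_sum_Q: "lam \<noteq> [] \<Longrightarrow> rook_eulerian lam = (\<Sum>i = 1..lam ! 0. Q lam i)"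
  using sum_monom_first_column[of lam "\<lambda>_. 1"] by (simp add: rook_eulerian_def)

lemma sum_over_first_column:
  assumes "sorted lam" "2 \<le> length lam" "1 \<le> i" "i \<le> lam ! 0"
  shows "(\<Sum>\<sigma> | \<sigma> \<in> row_complete_placements lam \<and> \<sigma> ! 0 = i. h \<sigma>) =
    (\<Sum>\<tau>\<in>row_complete_placements (remove_column lam). h (i # map (skip i) \<tau>))"
proof -
  obtain l ls where lam: "lam = l # ls"
    using assms(2) by (cases lam) auto
  have "inj (\<lambda>\<tau>. i # map (skip i) \<tau>)"
    using inj_mapI[OF inj_skip[of i]] by (simp add: inj_def)
  then have "inj_on (\<lambda>\<tau>. i # map (skip i) \<tau>) (row_complete_placements (remove_column lam))"
    by (rule inj_on_subset) simp
  moreover have "{\<sigma>. \<sigma> \<in> row_complete_placements lam \<and> \<sigma> ! 0 = i} =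
      (\<lambda>\<tau>. i # map (skip i) \<tau>) ` row_complete_placements (remove_column lam)"
    unfolding lam by (rule placements_first_column) (use assms lam in simp_all)
  ultimately show ?thesis
    by (simp only: sum.reindex o_def)
qed

text \<open>The first two rooks form an ascent exactly when the second one, in the columns of the
  smaller board, stands in column \<open>i\<close> or beyond, because \<open>skip i\<close> moves
  precisely those columns to the right of \<open>i\<close>.\<close>

lemma Q_recursion:
  assumes "sorted lam" "2 \<le> length lam" "1 \<le> i" "i \<le> lam ! 0" "mu = remove_column lam"
  shows "Q lam i = (\<Sum>j = 1..mu ! 0. (if i \<le> j then [:0, 1:] else 1) * Q mu j)"
proof -
  have "length mu = length lam - 1"
    by (simp add: assms(5) remove_column_def)
  then have ne: "mu \<noteq> []"
    using assms(2) by auto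
  have "Q lam i = (\<Sum>\<tau>\<in>row_complete_placements mu. monom 1 (asc (i # map (skip i) \<tau>)))"
    unfolding Q_def assms(5) by (rule sum_over_first_column[OF assms(1-4)])
  also have "\<dots> = (\<Sum>\<tau>\<in>row_complete_placements mu.
      (if i \<le> \<tau> ! 0 then [:0, 1:] else 1) * monom 1 (asc \<tau>))"
  proof (rule sum.cong)
    fix \<tau> assume "\<tau> \<in> row_complete_placements mu"
    then have "\<tau> \<noteq> []"
      using ne by (auto simp: row_complete_placements_def)
    then show "monom 1 (asc (i # map (skip i) \<tau>)) =
        (if i \<le> \<tau> ! 0 then [:0, 1 :: real:] else 1) * monom 1 (asc \<tau>)"
      by (simp add: asc_Cons asc_map_skip skip_def monom_Suc)
  qed simp
  also have "\<dots> = (\<Sum>j = 1..mu ! 0. (if i \<le> j then [:0, 1:] else 1) * Q mu j)"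
    by (rule sum_monom_first_column[OF ne])
  finally show ?thesis .
qed

lemma Q_single:
  assumes "1 \<le> i" "i \<le> l"
  shows "Q [l] i = 1"
proof -
  have "{\<sigma>. \<sigma> \<in> row_complete_placements [l] \<and> \<sigma> ! 0 = i} = {[i]}"
    using assms by (auto simp: row_complete_placements_def length_Suc_conv)
  then show ?thesis
    by (simp add: Q_def asc_def)
qed

lemma coeff_Q_nonneg: "coeff (Q lam i) k \<ge> 0"
  by (auto simp: Q_def coeff_sum intro!: sum_nonneg)

section \<open>The cone condition for all boards, by induction on the number of rows\<close>

lemma ceval_Q_recursion:
  assumes "sorted lam" "2 \<le> length lam" "1 \<le> i" "i \<le> lam ! 0" "mu = remove_column lam"
  shows "ceval (Q lam i) z =
    z * (\<Sum>j\<in>{1..mu ! 0} \<inter> {i..}. ceval (Q mu j) z) + (\<Sum>j\<in>{1..mu ! 0} \<inter> {..<i}. ceval (Q mu j) z)"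
proof -
  have "ceval (Q lam i) z = (\<Sum>j = 1..mu ! 0. if j \<in> {i..} then z * ceval (Q mu j) z else ceval (Q mu j) z)"
    unfolding Q_recursion[OF assms] ceval_sum by (rule sum.cong) simp_all
  also have "\<dots> = (\<Sum>j\<in>{1..mu ! 0} \<inter> {i..}. z * ceval (Q mu j) z) +
      (\<Sum>j\<in>{1..mu ! 0} \<inter> - {i..}. ceval (Q mu j) z)"
    by (simp add: sum.If_cases Collect_mem_eq del: atLeast_iff)
  also have "- {i..} = {..<i}" by auto
  finally show ?thesis by (simp only: sum_distrib_left)
qed

text \<open>A product \<open>u * cnj v\<close> replaces the quotient of \<open>u\<close> by
  \<open>v\<close>, from which it differs by a positive factor when \<open>v\<close> is nonzero.
  Both claims are proved together, since nonvanishing for a board uses both for the smaller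
  one.\<close>

lemma Q_cone:
  assumes "lam \<noteq> []" "sorted lam" "\<forall>k < length lam. lam ! k \<ge> Suc k" "Im z > 0"
  shows "\<lbrakk>1 \<le> i; i \<le> lam ! 0\<rbrakk> \<Longrightarrow> ceval (Q lam i) z \<noteq> 0"
    and "\<lbrakk>1 \<le> j; j \<le> i; i \<le> lam ! 0\<rbrakk> \<Longrightarrow> ceval (Q lam j) z * cnj (ceval (Q lam i) z) \<in> cone z"
proof -
  have "(\<forall>i. 1 \<le> i \<and> i \<le> lam ! 0 \<longrightarrow> ceval (Q lam i) z \<noteq> 0) \<and>
    (\<forall>i j. 1 \<le> j \<and> j \<le> i \<and> i \<le> lam ! 0 \<longrightarrow> ceval (Q lam j) z * cnj (ceval (Q lam i) z) \<in> cone z)"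
    using assms(1-3)
  proof (induction "length lam" arbitrary: lam rule: less_induct)
    case less
    show ?case
    proof (cases "length lam = 1")
      case True
      then obtain l where "lam = [l]" by (auto simp: length_Suc_conv)
      then show ?thesis using cone_real[of 1 z] by (auto simp: Q_single)
    next
      case False
      then have len: "2 \<le> length lam" using less.prems(1) by (cases lam) (auto simp: Suc_le_eq)
      define mu where "mu = remove_column lam"
      define m where "m = mu ! 0"
      define u where "u j = ceval (Q mu j) z" for j
      obtain l ls where lam: "lam = l # ls" "ls \<noteq> []" using len by (cases lam; cases "tl lam") auto
      have mu: "mu = map (\<lambda>x. x - 1) ls" by (simp add: mu_def lam remove_column_def)
      \<comment> \<open>The second row has at least two cells, so the smaller board still has a
        nonempty first row.\<close>
      have lm: "l \<le> Suc m" "m \<ge> 1"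
        using lam less.prems(2) less.prems(3)[rule_format, of 1] by (auto simp: m_def mu neq_Nil_conv)
      have "\<forall>k < length mu. Suc k \<le> mu ! k"
        using less.prems(3) unfolding mu lam by (auto dest: spec[of _ "Suc _"])
      moreover have "sorted mu"
        using less.prems(2) unfolding mu lam
        by (auto simp: sorted_map intro: sorted_wrt_mono_rel[of _ "(\<le>)"])
      ultimately have
          nz: "\<And>j. 1 \<le> j \<Longrightarrow> j \<le> m \<Longrightarrow> u j \<noteq> 0" and
          cn: "\<And>i j. 1 \<le> j \<Longrightarrow> j \<le> i \<Longrightarrow> i \<le> m \<Longrightarrow> u j * cnj (u i) \<in> cone z"
        using less.hyps[of mu] lam unfolding u_def m_def by (auto simp: mu)
      define S where "S J = (\<Sum>j\<in>{1..m} \<inter> J. u j)" for J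
      \<comment> \<open>The product of two block sums expands into products of pairs, each covered
        by the induction hypothesis.\<close>
      have S_cone: "S J * cnj (S I) \<in> cone z" if "\<And>i j. j \<in> J \<Longrightarrow> i \<in> I \<Longrightarrow> j \<le> i" for I J
        unfolding S_def cnj_sum sum_product by (intro cone_sum cn) (use that in auto)
      have S_nz: "S J \<noteq> 0" if "{1..m} \<inter> J \<noteq> {}" for J
        unfolding S_def
      proof (rule cone_sum_nonzero)
        \<comment> \<open>The reference term must have the largest index, as the cone condition
          compares an index only with those above it.\<close>
        show *: "Max ({1..m} \<inter> J) \<in> {1..m} \<inter> J" using that by (intro Max_in) auto
        then show "u (Max ({1..m} \<inter> J)) \<noteq> 0"
          using nz by auto
        show "u j * cnj (u (Max ({1..m} \<inter> J))) \<in> cone z" if "j \<in> {1..m} \<inter> J" for j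
          using * that by (intro cn Max_ge) auto
      qed (use assms in auto)
      have rec: "ceval (Q lam i) z = z * S {i..} + S {..<i}" if "1 \<le> i" "i \<le> lam ! 0" for i
        using ceval_Q_recursion[OF less.prems(2) len that mu_def, of z]
        by (simp add: S_def u_def m_def)
      have S_split: "S (I \<union> J) = S I + S J" if "I \<inter> J = {}" for I J
        unfolding S_def Int_Un_distrib by (intro sum.union_disjoint) (use that in auto)
      show ?thesis
      proof (intro conjI allI impI; elim conjE)
        fix i assume i: "1 \<le> i" "i \<le> lam ! 0"
        \<comment> \<open>Either sum may be empty, but the index \<open>m\<close> belongs to one of
          them.\<close>
        have "m \<in> {1..m} \<inter> {i..} \<or> m \<in> {1..m} \<inter> {..<i}"
          using lm(2) by auto
        then have "S {i..} \<noteq> 0 \<or> S {..<i} \<noteq> 0"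
          by (elim disj_forward) (rule S_nz, rule ex_in_conv[THEN iffD1, OF exI], assumption)+
        then show "ceval (Q lam i) z \<noteq> 0"
          unfolding rec[OF i]
          by (rule cone_shift_nonzero[rotated 2]) (rule S_cone, simp, rule assms(4))
      next
        fix i j assume ij: "1 \<le> j" "j \<le> i" "i \<le> lam ! 0"
        \<comment> \<open>Cutting at \<open>j\<close> and \<open>i\<close> gives three blocks; only
          the middle one has factor \<open>z\<close> in one polynomial and \<open>1\<close> in the
          other.\<close>
        have "S {j..} = S {i..} + S {j..<i}" "S {..<i} = S {j..<i} + S {..<j}"
          using ij by (subst S_split[symmetric]; force intro: arg_cong[where f = S])+
        then have "ceval (Q lam i) z = z * S {i..} + S {j..<i} + S {..<j}"
            "ceval (Q lam j) z = z * S {i..} + z * S {j..<i} + S {..<j}"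
          using rec[of i] rec[of j] ij by (simp_all add: algebra_simps)
        moreover have "S {j..<i} * cnj (S {i..}) \<in> cone z" "S {..<j} * cnj (S {i..}) \<in> cone z"
            "S {..<j} * cnj (S {j..<i}) \<in> cone z"
          using ij by (intro S_cone; simp)+
        ultimately show "ceval (Q lam j) z * cnj (ceval (Q lam i) z) \<in> cone z"
          using cone_blocks[of "S {j..<i}" "S {i..}" z "S {..<j}"] by simp
      qed
    qed
  qed
  then show "\<lbrakk>1 \<le> i; i \<le> lam ! 0\<rbrakk> \<Longrightarrow> ceval (Q lam i) z \<noteq> 0"
    and "\<lbrakk>1 \<le> j; j \<le> i; i \<le> lam ! 0\<rbrakk> \<Longrightarrow> ceval (Q lam j) z * cnj (ceval (Q lam i) z) \<in> cone z"
    by blast+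
qed

section \<open>From the cone condition to interlacing\<close>

text \<open>The continuous argument of the product of the factors \<open>t - a + \<i> / s\<close>. As \<open>s\<close> grows it
  tends to \<open>pi\<close> times the number of \<open>a\<close> exceeding \<open>t\<close>.\<close>

definition angle :: "real \<Rightarrow> real multiset \<Rightarrow> real \<Rightarrow> real" where
  "angle s M t = (\<Sum>a\<in>#M. pi / 2 - arctan (s * (t - a)))"

lemma angle_empty [simp]: "angle s {#} t = 0"
  by (simp add: angle_def)

lemma angle_add_mset [simp]: "angle s (add_mset a M) t = pi / 2 - arctan (s * (t - a)) + angle s M t"
  by (simp add: angle_def)

text \<open>The argument of a point of the upper half plane is the arccotangent of real over
  imaginary part, written through \<open>arctan\<close> so that it is smooth across
  \<open>t = a\<close>.\<close>

lemma linear_factor_polar: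
  assumes "s > 0"
  shows "Complex (t - a) (1 / s) =
    of_real (sqrt (1 + (s * (t - a))\<^sup>2) / s) * cis (pi / 2 - arctan (s * (t - a)))"
proof -
  have "sqrt (1 + (s * (t - a))\<^sup>2) > 0"
    by (simp add: add_pos_nonneg)
  then show ?thesis
    using assms by (simp add: complex_eq_iff cos_diff sin_diff cos_arctan sin_arctan)
qed

lemma prod_linear_factors_polar:
  assumes "s > 0"
  shows "\<exists>r>0. (\<Prod>a\<in>#M. ceval [:-a, 1:] (Complex t (1 / s))) = of_real r * cis (angle s M t)"
proof (induction M)
  case empty
  show ?case by (auto intro: exI[of _ 1])
next
  case (add a M)
  then obtain r where r: "r > 0"
      "(\<Prod>a\<in>#M. ceval [:-a, 1:] (Complex t (1 / s))) = of_real r * cis (angle s M t)"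
    by blast
  have "sqrt (1 + (s * (t - a))\<^sup>2) / s * r > 0"
    using r assms by (simp add: add_pos_nonneg)
  moreover have "ceval [:-a, 1:] (Complex t (1 / s)) = Complex (t - a) (1 / s)"
    by (simp add: complex_eq_iff)
  ultimately show ?case
    using r(2) linear_factor_polar[OF assms, of t a]
    by (intro exI[of _ "sqrt (1 + (s * (t - a))\<^sup>2) / s * r"]) (simp add: cis_mult[symmetric] mult_ac)
qed

lemma ceval_polar:
  assumes "real_rooted p" "lead_coeff p > 0" "s > 0"
  shows "\<exists>r>0. ceval p (Complex t (1 / s)) = of_real r * cis (angle s (proots p) t)"
proof -
  obtain r where "r > 0"
      "(\<Prod>a\<in>#proots p. ceval [:-a, 1:] (Complex t (1 / s))) = of_real r * cis (angle s (proots p) t)"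
    using prod_linear_factors_polar[OF assms(3)] by blast
  moreover obtain c where c: "p = smult c (\<Prod>a\<in>#proots p. [:-a, 1:])" "c = lead_coeff p"
    using real_rooted_factorization[OF assms(1)] by metis
  have "ceval p (Complex t (1 / s)) = of_real c * (\<Prod>a\<in>#proots p. ceval [:-a, 1:] (Complex t (1 / s)))"
    by (subst c(1)) (simp add: image_mset.compositionality comp_def)
  ultimately show ?thesis
    using c(2) assms(2) by (intro exI[of _ "c * r"]) simp
qed

lemma continuous_angle: "continuous_on UNIV (angle s M)"
  by (induction M) (auto simp: angle_def intro!: continuous_intros)

lemma angle_at_top:
  assumes "s > 0" shows "(angle s M \<longlongrightarrow> 0) at_top"
proof (induction M)
  case (add a M)
  have "filterlim (\<lambda>t. s * (- a + t)) at_top at_top"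
    using assms by (intro filterlim_tendsto_pos_mult_at_top[OF tendsto_const]
        filterlim_tendsto_add_at_top[OF tendsto_const] filterlim_ident)
  then have "((\<lambda>t. arctan (s * (- a + t))) \<longlongrightarrow> pi / 2) at_top"
    by (rule filterlim_compose[OF tendsto_arctan_at_top])
  from tendsto_add[OF tendsto_diff[OF tendsto_const[of "pi / 2"] this] add]
  show ?case by simp
qed simp

text \<open>A factor contributes \<open>pi\<close> in the limit if \<open>a > x\<close> and
  \<open>0\<close> if \<open>a < x\<close>; at \<open>a = x\<close> it would stay at
  \<open>pi / 2\<close>.\<close>

lemma angle_limit:
  assumes "x \<notin># M"
  shows "((\<lambda>s. angle s M x) \<longlongrightarrow> pi * real (size {#a \<in># M. a > x#})) at_top"
  using assms
proof (induction M)
  case (add a M)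
  have "((\<lambda>s. arctan (s * (x - a))) \<longlongrightarrow> (if a > x then - (pi / 2) else pi / 2)) at_top"
  proof (cases "a > x")
    case True
    then have "filterlim (\<lambda>s. s * (x - a)) at_bot at_top"
      using filterlim_tendsto_neg_mult_at_bot[OF tendsto_const, of "x - a" "\<lambda>s. s" at_top]
      by (simp add: filterlim_ident mult.commute)
    then show ?thesis
      using True filterlim_compose[OF tendsto_arctan_at_bot] by auto
  next
    case False
    then have "filterlim (\<lambda>s. s * (x - a)) at_top at_top"
      using add filterlim_tendsto_pos_mult_at_top[OF tendsto_const, of "x - a" "\<lambda>s. s" at_top]
      by (simp add: filterlim_ident mult.commute)
    then show ?thesis
      using False filterlim_compose[OF tendsto_arctan_at_top] by auto
  qed
  from tendsto_add[OF tendsto_diff[OF tendsto_const[of "pi / 2"] this] add.IH]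
  show ?case using add.prems by (auto simp: algebra_simps split: if_splits)
qed simp

section \<open>Zero counts from the continuous argument of a quotient\<close>

locale cone_pair =
  fixes f g :: "real poly"
  assumes rr: "real_rooted f" "real_rooted g"
    and lc: "lead_coeff f > 0" "lead_coeff g > 0"
    and cone: "\<And>z. Im z > 0 \<Longrightarrow> ceval g z * cnj (ceval f z) \<in> cone z"
begin

text \<open>A continuous branch of the argument of \<open>g / f\<close> on the line at height
  \<open>1 / s\<close>.\<close>

definition gap :: "real \<Rightarrow> real \<Rightarrow> real" where
  "gap s t = angle s (proots g) t - angle s (proots f) t"

text \<open>The cone lies in the closed upper half plane and misses the negative reals, so modulo
  \<open>2 * pi\<close> the gap lies in \<open>[0, pi)\<close>.\<close>

lemma cis_gap:
  assumes "s > 0"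
  shows "sin (gap s t) \<ge> 0" "gap s t \<noteq> pi"
proof -
  let ?z = "Complex t (1 / s)"
  obtain r where r: "r > 0" "ceval f ?z = of_real r * cis (angle s (proots f) t)"
    using ceval_polar[OF rr(1) lc(1) assms] by blast
  obtain q where q: "q > 0" "ceval g ?z = of_real q * cis (angle s (proots g) t)"
    using ceval_polar[OF rr(2) lc(2) assms] by blast
  have z: "Im ?z > 0" using assms by simp
  have "ceval g ?z * cnj (ceval f ?z) = of_real (q * r) * cis (gap s t)"
    unfolding r q gap_def by (simp add: cis_cnj cis_mult)
  then have c: "of_real (q * r) * cis (gap s t) \<in> cone ?z"
    using cone[OF z] by simp
  have qr: "q * r > 0" using q r by simp
  show "sin (gap s t) \<ge> 0"
    using cone_Im[OF c z] qr by (simp add: zero_le_mult_iff del: of_real_mult)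
  show "gap s t \<noteq> pi"
  proof
    assume "gap s t = pi"
    then show False using cone_not_negative[OF c z] qr by (simp del: of_real_mult)
  qed
qed

text \<open>Starting near \<open>0\<close> far to the right, the gap would by the intermediate value
  theorem have to take a value in \<open>(-pi, 0)\<close> or the value \<open>pi\<close> in order to
  escape.\<close>

lemma gap_bounds:
  assumes s: "s > 0"
  shows "0 \<le> gap s x" "gap s x \<le> pi"
proof -
  have cont: "continuous_on A (gap s)" for A
    unfolding gap_def using continuous_on_subset[OF continuous_angle]
    by (intro continuous_intros) auto
  have "(gap s \<longlongrightarrow> 0 - 0) at_top"
    unfolding gap_def using angle_at_top[OF s] by (intro tendsto_diff)
  then have "eventually (\<lambda>t. dist (gap s t) (0 - 0) < 1) at_top"
    by (rule tendstoD) simp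
  then have "eventually (\<lambda>t. dist (gap s t) (0 - 0) < 1 \<and> t \<ge> x) at_top"
    using eventually_ge_at_top by (rule eventually_conj)
  then obtain T where T: "\<bar>gap s T\<bar> < 1" "T \<ge> x"
    using eventually_happens[of _ "at_top :: real filter"] by (auto simp: dist_real_def)
  have neg: "\<not> (- pi < gap s t \<and> gap s t < 0)" for t
    using cis_gap(1)[OF s, of t] sin_gt_zero[of "- gap s t"] by auto
  have T0: "0 \<le> gap s T"
    using neg[of T] T pi_ge_two by linarith
  show "0 \<le> gap s x"
  proof (rule ccontr)
    assume "\<not> 0 \<le> gap s x"
    \<comment> \<open>The cap at \<open>-1\<close> keeps the level inside the forbidden interval
      \<open>(-pi, 0)\<close>, however negative \<open>gap s x\<close> is.\<close>
    then obtain t where "gap s t = max (gap s x) (- 1)"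
      using IVT'[of "gap s" x "max (gap s x) (- 1)" T] T T0 cont by force
    then show False using neg[of t] \<open>\<not> 0 \<le> gap s x\<close> pi_ge_two by auto
  qed
  show "gap s x \<le> pi"
  proof (rule ccontr)
    assume "\<not> gap s x \<le> pi"
    then obtain t where "gap s t = pi"
      using IVT2'[of "gap s" T pi x] T pi_ge_two cont by force
    then show False using cis_gap(2)[OF s] by blast
  qed
qed

text \<open>Letting \<open>s\<close> tend to infinity in \<open>gap_bounds\<close> confines
  \<open>pi\<close> times the difference of the counts to \<open>[0, pi]\<close>.\<close>

lemma count_zeros_above:
  assumes "poly f x \<noteq> 0" "poly g x \<noteq> 0"
  defines "N \<equiv> \<lambda>p. size {#a \<in># proots p. a > x#}"
  shows "N f \<le> N g" "N g \<le> Suc (N f)"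
proof -
  have "x \<notin># proots f" "x \<notin># proots g"
    using assms rr real_rooted_nonzero by auto
  then have lim: "((\<lambda>s. gap s x) \<longlongrightarrow> pi * real (N g) - pi * real (N f)) at_top"
    unfolding gap_def N_def by (intro tendsto_diff angle_limit)
  have "0 \<le> pi * real (N g) - pi * real (N f)"
    by (rule tendsto_lowerbound[OF lim])
       (auto intro: eventually_mono[OF eventually_gt_at_top[of 0]] gap_bounds)
  then show "N f \<le> N g"
    by (simp flip: right_diff_distrib add: zero_le_mult_iff) (use pi_gt_zero in linarith)
  have "pi * real (N g) - pi * real (N f) \<le> pi"
    by (rule tendsto_upperbound[OF lim])
       (auto intro: eventually_mono[OF eventually_gt_at_top[of 0]] gap_bounds)
  then have "pi * real (N g) \<le> pi * real (Suc (N f))"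
    by (simp add: algebra_simps)
  then show "N g \<le> Suc (N f)"
    by (subst (asm) mult_le_cancel_left_pos) auto
qed

end

section \<open>Interlacing of sorted zeros from zero counts\<close>

lemma zeros_desc_props:
  assumes "real_rooted p"
  shows "mset (zeros_desc p) = proots p" "sorted_wrt (\<ge>) (zeros_desc p)"
    "length (zeros_desc p) = degree p" "set (zeros_desc p) = {x. poly p x = 0}"
proof -
  show m: "mset (zeros_desc p) = proots p"
    by (simp add: zeros_desc_def)
  show "sorted_wrt (\<ge>) (zeros_desc p)"
    by (simp add: zeros_desc_def sorted_wrt_rev)
  show "length (zeros_desc p) = degree p"
    using real_rooted_factorization[OF assms] m by (metis size_mset)
  show "set (zeros_desc p) = {x. poly p x = 0}"
    using real_rooted_nonzero[OF assms] m by (metis set_mset_mset set_count_proots)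
qed

text \<open>The entries above \<open>x\<close> form an initial segment of a decreasing list, so
  comparing entry \<open>k\<close> with \<open>x\<close> bounds their number. The conditional
  hypothesis of the second claim also covers \<open>k\<close> beyond the end.\<close>

lemma count_above_desc:
  fixes xs :: "real list"
  assumes "sorted_wrt (\<ge>) xs"
  shows "k < length xs \<Longrightarrow> xs ! k > x \<Longrightarrow> k < size {#a \<in># mset xs. a > x#}"
    and "(k < length xs \<Longrightarrow> xs ! k \<le> x) \<Longrightarrow> size {#a \<in># mset xs. a > x#} \<le> k"
proof -
  have N: "size {#a \<in># mset xs. a > x#} = length (filter (\<lambda>a. a > x) xs)"
    by (metis mset_filter size_mset)
  have desc: "xs ! j \<le> xs ! i" if "i \<le> j" "j < length xs" for i j
    using assms that by (cases "i = j") (auto simp: sorted_wrt_iff_nth_less)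
  show "k < size {#a \<in># mset xs. a > x#}" if k: "k < length xs" "xs ! k > x"
  proof -
    have "\<forall>a\<in>set (take (Suc k) xs). a > x"
      using k desc by (auto simp: in_set_conv_nth) (metis less_Suc_eq_le order_less_le_trans)
    then have "filter (\<lambda>a. a > x) (take (Suc k) xs) = take (Suc k) xs" by simp
    then have "Suc k = length (filter (\<lambda>a. a > x) (take (Suc k) xs))"
      using k by simp
    also have "\<dots> \<le> length (filter (\<lambda>a. a > x) (take (Suc k) xs @ drop (Suc k) xs))"
      unfolding filter_append by simp
    finally show ?thesis unfolding N by simp
  qed
  show "size {#a \<in># mset xs. a > x#} \<le> k" if k: "k < length xs \<Longrightarrow> xs ! k \<le> x"
  proof -
    have "\<forall>a\<in>set (drop k xs). \<not> a > x"
    proof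
      fix a assume "a \<in> set (drop k xs)"
      then obtain j where "j < length (drop k xs)" "a = drop k xs ! j"
        by (metis in_set_conv_nth)
      then show "\<not> a > x" using desc[of k "k + j"] k by fastforce
    qed
    then have "filter (\<lambda>a. a > x) (drop k xs) = []" by simp
    then have "length (filter (\<lambda>a. a > x) (take k xs @ drop k xs)) \<le> k"
      unfolding filter_append by (simp add: le_trans[OF length_filter_le])
    then show ?thesis unfolding N by simp
  qed
qed

lemma (in cone_pair) avoiding_zeros:
  assumes "l < (u :: real)"
  shows "\<exists>x. l < x \<and> x < u \<and> poly f x \<noteq> 0 \<and> poly g x \<noteq> 0"
proof -
  have "finite {x. poly (f * g) x = 0}"
    using rr real_rooted_nonzero by (intro poly_roots_finite) auto
  then have "\<not> {l<..<u} \<subseteq> {x. poly (f * g) x = 0}"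
    using assms finite_subset infinite_Ioo by blast
  then show ?thesis by auto
qed

text \<open>A violated inequality leaves an open interval between two zeros; at a point of it that
  is a zero of neither polynomial, the counts contradict \<open>count_zeros_above\<close>.\<close>

lemma (in cone_pair) interlaces:
  assumes "\<And>x. poly f x = 0 \<Longrightarrow> x \<le> 0" "\<And>x. poly g x = 0 \<Longrightarrow> x \<le> 0"
  shows "f \<preceq> g"
proof -
  note F = zeros_desc_props[OF rr(1)] and G = zeros_desc_props[OF rr(2)]
  let ?as = "zeros_desc f" and ?bs = "zeros_desc g"
  define N where "N x p = size {#a \<in># proots p. a > x#}" for x :: real and p
  have N: "N x f \<le> N x g" "N x g \<le> Suc (N x f)" if "poly f x \<noteq> 0" "poly g x \<noteq> 0" for x
    using count_zeros_above[OF that] unfolding N_def by auto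
  note cf = count_above_desc[OF F(2), unfolded F(1,3), folded N_def]
  note cg = count_above_desc[OF G(2), unfolded G(1,3), folded N_def]
  have "finite {x. poly (f * g) x = 0}"
    using rr real_rooted_nonzero by (intro poly_roots_finite) auto
  then have "bdd_below {x. poly (f * g) x = 0}" by simp
  then obtain m where m: "\<And>x. poly (f * g) x = 0 \<Longrightarrow> m \<le> x"
    unfolding bdd_below_def by auto
  \<comment> \<open>Below all zeros the counts are the degrees, which yields the degree
    condition.\<close>
  have all: "N (m - 1) p = degree p" if "p \<in> {f, g}" for p
  proof -
    have "poly p x = 0 \<Longrightarrow> m \<le> x" "real_rooted p" for x
      using that m[of x] rr by auto
    then have "{#a \<in># proots p. a > m - 1#} = proots p" 
      using real_rooted_nonzero by (subst filter_mset_eq_conv) force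
    then show ?thesis unfolding N_def using real_rooted_factorization \<open>real_rooted p\<close> by metis
  qed
  have "poly (f * g) (m - 1) \<noteq> 0" using m[of "m - 1"] by auto
  then have deg: "degree f \<le> degree g" "degree g \<le> Suc (degree f)"
    using N[of "m - 1"] all by auto
  have 1: "?as ! k \<le> ?bs ! k" if k: "k < degree f" for k
  proof (rule ccontr)
    assume "\<not> ?as ! k \<le> ?bs ! k"
    then obtain x where x: "?bs ! k < x" "x < ?as ! k" "poly f x \<noteq> 0" "poly g x \<noteq> 0"
      using avoiding_zeros[of "?bs ! k" "?as ! k"] by auto
    then show False using cf(1)[of k x] cg(2)[of k x] k N(1)[of x] by auto
  qed
  have 2: "?bs ! (k + 1) \<le> ?as ! k" if k: "k + 1 < degree g" for k
  proof (rule ccontr)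
    assume "\<not> ?bs ! (k + 1) \<le> ?as ! k"
    then obtain x where x: "?as ! k < x" "x < ?bs ! (k + 1)" "poly f x \<noteq> 0" "poly g x \<noteq> 0"
      using avoiding_zeros[of "?as ! k" "?bs ! (k + 1)"] by auto
    \<comment> \<open>Here \<open>g\<close> has at least \<open>k + 2\<close> zeros above
      \<open>x\<close> and \<open>f\<close> at most \<open>k\<close>.\<close>
    then show False using cf(2)[of k x] cg(1)[of "k + 1" x] k N(2)[of x] by auto
  qed
  show ?thesis
    unfolding interlaces_def using rr lc assms deg 1 2 by auto
qed

text \<open>At a positive point the leading term is positive and no other term is negative.\<close>

lemma nonneg_coeffs_zeros:
  fixes p :: "real poly"
  assumes "\<And>k. coeff p k \<ge> 0" "p \<noteq> 0" "poly p x = 0"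
  shows "x \<le> 0"
proof (rule ccontr)
  assume "\<not> x \<le> 0"
  then have "0 < coeff p (degree p) * x ^ degree p"
    using assms(1)[of "degree p"] assms(2) by (simp add: le_less)
  also have "\<dots> \<le> (\<Sum>k\<le>degree p. coeff p k * x ^ k)"
    using \<open>\<not> x \<le> 0\<close> assms(1) by (intro member_le_sum) auto
  finally show False using assms(3) by (simp add: poly_altdef)
qed

section \<open>The interlacing theorem\<close>

theorem theorem2p6:
  fixes n :: nat and lam :: "nat list"
  assumes "n > 1"
    and "length lam = n"
    and "ferrers_board lam"
    and "\<forall>i < n. lam ! i \<ge> i + 1"
  shows "interlacing (map (Q lam) (rev [1..<lam ! 0 + 1])) \<and>
         rook_eulerian lam = (\<Sum>i = 1..lam ! 0. Q lam i) \<and>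
         real_rooted (rook_eulerian lam)"
proof -
  let ?m = "lam ! 0"
  have lam: "lam \<noteq> []" "sorted lam" "\<forall>k < length lam. lam ! k \<ge> Suc k"
    using assms by (auto simp: ferrers_board_def)
  note nz = Q_cone(1)[OF lam] and cn = Q_cone(2)[OF lam]
  have rr: "real_rooted (Q lam i)" if "1 \<le> i" "i \<le> ?m" for i
    using nz that by (intro real_rootedI_upper_half_plane)
  have lc: "lead_coeff (Q lam i) > 0" if "1 \<le> i" "i \<le> ?m" for i
    using real_rooted_nonzero[OF rr[OF that]] coeff_Q_nonneg[of lam i]
    by (simp add: order_less_le)
  have "Q lam i \<preceq> Q lam j" if ij: "1 \<le> j" "j \<le> i" "i \<le> ?m" for i j
  proof -
    have "cone_pair (Q lam i) (Q lam j)"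
      by (rule cone_pair.intro) (use ij rr lc cn in auto)
    then show ?thesis
      using ij rr[THEN real_rooted_nonzero] coeff_Q_nonneg
      by (intro cone_pair.interlaces nonneg_coeffs_zeros) auto
  qed
  \<comment> \<open>Later positions carry smaller columns, which matches the direction of the
    relation just shown.\<close>
  moreover have "rev [1..<?m + 1] ! k = ?m - k" if "k < ?m" for k
    using that by (subst rev_nth) (auto simp del: upt_Suc)
  ultimately have "interlacing (map (Q lam) (rev [1..<?m + 1]))"
    unfolding interlacing_def using rr by (auto simp del: upt_Suc)
  moreover have "real_rooted (rook_eulerian lam)"
  proof (rule real_rootedI_upper_half_plane)
    fix z :: complex assume z: "Im z > 0"
    \<comment> \<open>The largest column again serves as the reference term.\<close>
    have "?m \<in> {1..?m}" using lam(1) lam(3)[rule_format, of 0] by simp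
    then have "(\<Sum>i = 1..?m. ceval (Q lam i) z) \<noteq> 0"
      using nz[OF z] cn[OF z] z by (intro cone_sum_nonzero[of _ ?m]) auto
    then show "ceval (rook_eulerian lam) z \<noteq> 0"
      using rook_eulerian_eq_sum_Q[OF lam(1)] by simp
  qed
  ultimately show ?thesis
    using rook_eulerian_eq_sum_Q[OF lam(1)] by blast
qed

end
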